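(* Let $X$ be a Urysohn space with a regular $G_\delta$-diagonal. Then $|X|\le aL(X)^{\omega}$.
   Context: A topological space $X$ is Urysohn if every two distinct points of $X$ have disjoint closed neighborhoods. Write $\Delta_X=\{(x,x)\in X^2:x\in X\}$. $X$ has a regular $G_\delta$-diagonal if there is a sequence $(U_n:n<\omega)$ of open sets in $X^2$ such that $\Delta_X=\bigcap_{n<\omega}U_n=\bigcap_{n<\omega}\overline{U_n}$. The almost Lindelöf number $aL(X)$ is the smallest infinite cardinal $\kappa$ such that for every open cover $\mathcal{U}$ of $X$ there is a subcollection $\mathcal{U}_0\subset\mathcal{U}$ with $|\mathcal{U}_0|\le\kappa$ and $\bigcup\{\overline{U}:U\in\mathcal{U}_0\}=X$. *)

theory Defs
  imports "HOL-Analysis.Analysis"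
begin

unbundle cardinal_syntax

definition closed_neighbourhood :: "'a topology \<Rightarrow> 'a \<Rightarrow> 'a set \<Rightarrow> bool" where
  "closed_neighbourhood X x C \<longleftrightarrow> closedin X C \<and> (\<exists>U. openin X U \<and> x \<in> U \<and> U \<subseteq> C)"

definition Urysohn_space :: "'a topology \<Rightarrow> bool" where
  "Urysohn_space X \<longleftrightarrow>
     (\<forall>x\<in>topspace X. \<forall>y\<in>topspace X. x \<noteq> y \<longrightarrow>
        (\<exists>C D. closed_neighbourhood X x C \<and> closed_neighbourhood X y D \<and> disjnt C D))"

definition diagonal_in :: "'a topology \<Rightarrow> ('a \<times> 'a) set" where
  "diagonal_in X = {(x, x) |x. x \<in> topspace X}"

definition regular_gdelta_diagonal :: "'a topology \<Rightarrow> bool" where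
  "regular_gdelta_diagonal X \<longleftrightarrow>
     (\<exists>U :: nat \<Rightarrow> ('a \<times> 'a) set.
        (\<forall>n. openin (prod_topology X X) (U n)) \<and>
        diagonal_in X = (\<Inter>n. U n) \<and>
        diagonal_in X = (\<Inter>n. prod_topology X X closure_of U n))"

definition almost_Lindelof_bound :: "'a topology \<Rightarrow> 'k rel \<Rightarrow> bool" where
  "almost_Lindelof_bound X \<kappa> \<longleftrightarrow>
     (\<forall>\<U>. (\<forall>U\<in>\<U>. openin X U) \<and> \<Union>\<U> = topspace X \<longrightarrow>
        (\<exists>\<U>0\<subseteq>\<U>. |\<U>0| \<le>o \<kappa> \<and> (\<Union>U\<in>\<U>0. X closure_of U) = topspace X))"

text \<open>
  A cardinal is represented, up to \<open>=o\<close>, by a relation on some type, so the least cardinal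
  has to be chosen on a fixed type. The type \<open>'a + nat\<close> is infinite and large enough to carry
  a bound for every topology on \<open>'a\<close>; by the lemmas below the value satisfies the defining
  property and is minimal among the infinite cardinals on \<^emph>\<open>arbitrary\<close> types.
\<close>

definition almost_Lindelof_number :: "'a topology \<Rightarrow> ('a + nat) rel" where
  "almost_Lindelof_number X =
     (SOME \<kappa>. Cinfinite \<kappa> \<and> almost_Lindelof_bound X \<kappa> \<and>
        (\<forall>\<kappa>' :: ('a + nat) rel. Cinfinite \<kappa>' \<and> almost_Lindelof_bound X \<kappa>' \<longrightarrow> \<kappa> \<le>o \<kappa>'))"

lemma almost_Lindelof_bound_mono:
  assumes "almost_Lindelof_bound X r" "r \<le>o s"
  shows "almost_Lindelof_bound X s"
  using assms unfolding almost_Lindelof_bound_def by (meson ordLeq_transitive)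

lemma almost_Lindelof_bound_UNIV:
  "almost_Lindelof_bound (X :: 'a topology) |UNIV :: ('a + nat) set|"
  unfolding almost_Lindelof_bound_def
proof (intro allI impI)
  fix \<U> :: "'a set set"
  assume U: "(\<forall>U\<in>\<U>. openin X U) \<and> \<Union>\<U> = topspace X"
  then have "\<forall>x\<in>topspace X. \<exists>V. V \<in> \<U> \<and> x \<in> V" by blast
  then obtain f where f: "\<And>x. x \<in> topspace X \<Longrightarrow> f x \<in> \<U> \<and> x \<in> f x" by metis
  have "|f ` topspace X| \<le>o |topspace X|" by (rule card_of_image)
  moreover have "|topspace X| \<le>o |UNIV :: ('a + nat) set|"
    by (rule card_of_ordLeqI[of Inl]) auto
  ultimately have 1: "|f ` topspace X| \<le>o |UNIV :: ('a + nat) set|"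
    by (rule ordLeq_transitive)
  have 2: "topspace X \<subseteq> (\<Union>V\<in>f ` topspace X. X closure_of V)"
  proof
    fix x assume x: "x \<in> topspace X"
    then have "f x \<subseteq> topspace X" using U f openin_subset by metis
    then have "x \<in> X closure_of f x" using f[OF x] closure_of_subset by blast
    then show "x \<in> (\<Union>V\<in>f ` topspace X. X closure_of V)" using x by blast
  qed
  have 3: "(\<Union>V\<in>f ` topspace X. X closure_of V) \<subseteq> topspace X"
    by (meson UN_least closure_of_subset_topspace)
  show "\<exists>\<U>0\<subseteq>\<U>. |\<U>0| \<le>o |UNIV :: ('a + nat) set| \<and>
          (\<Union>U\<in>\<U>0. X closure_of U) = topspace X"
    using 1 2 3 f by (intro exI[of _ "f ` topspace X"]) blast
qed

lemma almost_Lindelof_number_spec: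
  fixes X :: "'a topology"
  shows "Cinfinite (almost_Lindelof_number X) \<and>
     almost_Lindelof_bound X (almost_Lindelof_number X) \<and>
     (\<forall>\<kappa>' :: ('a + nat) rel. Cinfinite \<kappa>' \<and> almost_Lindelof_bound X \<kappa>' \<longrightarrow>
        almost_Lindelof_number X \<le>o \<kappa>')"
proof -
  define R where "R = {\<kappa> :: ('a + nat) rel. Cinfinite \<kappa> \<and> almost_Lindelof_bound X \<kappa>}"
  have "|UNIV :: ('a + nat) set| \<in> R"
    using almost_Lindelof_bound_UNIV[of X]
    by (simp add: R_def cinfinite_def Field_card_of card_of_card_order_on)
  then have "R \<noteq> {}" by blast
  moreover have "\<forall>r\<in>R. Card_order r" by (simp add: R_def)
  ultimately obtain r where r: "r \<in> R" "\<forall>r'\<in>R. r \<le>o r'"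
    using exists_minim_Card_order[of R] by auto
  show ?thesis
    unfolding almost_Lindelof_number_def
    by (rule someI[of _ r]) (use r in \<open>simp add: R_def\<close>)
qed

lemma Cinfinite_almost_Lindelof_number: "Cinfinite (almost_Lindelof_number X)"
  and almost_Lindelof_bound_number: "almost_Lindelof_bound X (almost_Lindelof_number X)"
  using almost_Lindelof_number_spec[of X] by simp_all

lemma almost_Lindelof_number_least:
  fixes X :: "'a topology" and \<kappa> :: "'k rel"
  assumes "Cinfinite \<kappa>" "almost_Lindelof_bound X \<kappa>"
  shows "almost_Lindelof_number X \<le>o \<kappa>"
proof (rule ccontr)
  assume n: "\<not> almost_Lindelof_number X \<le>o \<kappa>"
  then have "\<kappa> \<le>o almost_Lindelof_number X"
    using assms Cinfinite_almost_Lindelof_number[of X]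
    by (meson card_order_on_well_order_on ordLeq_total)
  then obtain p :: "('a + nat) rel" where p: "\<kappa> =o p"
    using internalize_ordLeq[of \<kappa> "almost_Lindelof_number X"] by blast
  have "Cinfinite p" using p assms(1) Cinfinite_cong by blast
  moreover have "almost_Lindelof_bound X p"
    using almost_Lindelof_bound_mono assms(2) p ordIso_iff_ordLeq by blast
  ultimately have "almost_Lindelof_number X \<le>o p"
    using almost_Lindelof_number_spec[of X] by simp
  then have "almost_Lindelof_number X \<le>o \<kappa>"
    using ordIso_symmetric[OF p] by (rule ordLeq_ordIso_trans)
  then show False using n by contradiction
qed

end

theory Submission
  imports Defs
begin

text \<open>
  Let \<open>U n\<close> witness the regular \<open>G\<^sub>\<delta>\<close>-diagonal. For each \<open>n\<close>, the open sets \<open>V\<close> with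
  \<open>V \<times> V \<subseteq> U n\<close> cover \<open>X\<close>, so at most \<open>aL(X)\<close> of them have closures covering \<open>X\<close>. Code a point
  \<open>y\<close> by a sequence that picks, for each \<open>n\<close>, one of these sets with \<open>y\<close> in its closure. If \<open>y\<close>
  and \<open>z\<close> have the same code, then \<open>(y, z)\<close> lies in the closure of every \<open>U n\<close>, whence \<open>y = z\<close>.
\<close>

text \<open>Around each diagonal point, \<open>U\<close> contains an open square, so the sides of
  such squares form an open cover to which the bound \<open>\<kappa>\<close> applies.\<close>

lemma almost_Lindelof_bound_square_cover:
  assumes "almost_Lindelof_bound X \<kappa>"
    and "openin (prod_topology X X) U" and "diagonal_in X \<subseteq> U"
  obtains \<V> where "|\<V>| \<le>o \<kappa>" "\<And>V. V \<in> \<V> \<Longrightarrow> V \<times> V \<subseteq> U"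
    "(\<Union>V\<in>\<V>. X closure_of V) = topspace X"
proof -
  define \<W> where "\<W> = {V. openin X V \<and> V \<times> V \<subseteq> U}"
  have "\<exists>V\<in>\<W>. x \<in> V" if x: "x \<in> topspace X" for x
  proof -
    have "(x, x) \<in> U"
      using x assms(3) by (auto simp: diagonal_in_def)
    with assms(2)[unfolded openin_prod_topology_alt, rule_format]
    obtain A B where "openin X A" "openin X B" "x \<in> A" "x \<in> B" "A \<times> B \<subseteq> U"
      by metis
    \<comment> \<open>Intersecting the sides shrinks the box to a square: (A \<inter> B) \<times> (A
      \<inter> B) \<subseteq> A \<times> B.\<close>
    then have "A \<inter> B \<in> \<W>" "x \<in> A \<inter> B"
      unfolding \<W>_def by auto
    then show ?thesis by blast
  qed
  moreover have "V \<subseteq> topspace X" if "V \<in> \<W>" for V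
    using that openin_subset by (auto simp: \<W>_def)
  ultimately have "\<Union>\<W> = topspace X"
    by blast
  moreover have "\<forall>V\<in>\<W>. openin X V"
    by (simp add: \<W>_def)
  ultimately obtain \<V> where \<V>: "\<V> \<subseteq> \<W>" "|\<V>| \<le>o \<kappa>" "(\<Union>V\<in>\<V>. X closure_of V) = topspace X"
    using assms(1)[unfolded almost_Lindelof_bound_def, rule_format, of \<W>] by metis
  have "V \<times> V \<subseteq> U" if "V \<in> \<V>" for V
    using subsetD[OF \<V>(1) that] by (simp add: \<W>_def)
  with \<V>(2,3) show thesis
    by (intro that)
qed

text \<open>Injecting each \<open>\<V> n\<close> into \<open>Field \<kappa>\<close> turns the code
  of a point into a sequence in \<open>Field \<kappa>\<close>. The injection depends on
  \<open>n\<close> only, so different codes stay different.\<close>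

lemma card_of_le_cexp_natLeq:
  fixes c :: "'a \<Rightarrow> nat \<Rightarrow> 'b"
  assumes "Card_order \<kappa>" and "\<And>n. |\<V> n| \<le>o \<kappa>"
    and mem: "\<And>x n. x \<in> S \<Longrightarrow> c x n \<in> \<V> n" and "inj_on c S"
  shows "|S| \<le>o \<kappa> ^c natLeq"
proof -
  have "|\<V> n| \<le>o |Field \<kappa>|" for n
    using assms(1,2) card_of_Field_ordIso ordIso_symmetric ordLeq_ordIso_trans by blast
  then have "\<forall>n. \<exists>g. inj_on g (\<V> n) \<and> g ` \<V> n \<subseteq> Field \<kappa>"
    by (simp add: card_of_ordLeq)
  then obtain g where inj: "\<And>n. inj_on (g n) (\<V> n)" and sub: "\<And>n. g n ` \<V> n \<subseteq> Field \<kappa>"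
    by metis
  define h where "h x = (\<lambda>n. g n (c x n))" for x
  have "inj_on h S"
  proof (rule inj_onI)
    fix x y assume xy: "x \<in> S" "y \<in> S" "h x = h y"
    have "c x n = c y n" for n
      using fun_cong[OF xy(3), of n] inj_onD[OF inj[of n]] mem xy(1,2) by (simp add: h_def)
    then show "x = y"
      using assms(4) xy by (meson ext inj_onD)
  qed
  \<comment> \<open>\<open>Field natLeq\<close> is all of \<open>nat\<close>, so the clause of
    \<open>Func\<close> that demands \<open>undefined\<close> off the domain is vacuous.\<close>
  moreover have "h ` S \<subseteq> Func (Field natLeq) (Field \<kappa>)"
    using sub mem by (fastforce simp: h_def Func_def Field_natLeq)
  ultimately show ?thesis
    unfolding cexp_def using card_of_ordLeq by blast
qed

theorem corollary4p17:
  fixes X :: "'a topology"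
  assumes "Urysohn_space X"
    and "regular_gdelta_diagonal X"
  shows "|topspace X| \<le>o almost_Lindelof_number X ^c natLeq"
proof -
  obtain U :: "nat \<Rightarrow> ('a \<times> 'a) set" where
    U: "\<And>n. openin (prod_topology X X) (U n)" "diagonal_in X = (\<Inter>n. U n)"
      "diagonal_in X = (\<Inter>n. prod_topology X X closure_of U n)"
    using assms(2) unfolding regular_gdelta_diagonal_def by blast
  have "\<exists>\<V>. |\<V>| \<le>o almost_Lindelof_number X \<and> (\<forall>V\<in>\<V>. V \<times> V \<subseteq> U n) \<and>
      (\<Union>V\<in>\<V>. X closure_of V) = topspace X" for n
  proof -
    have "diagonal_in X \<subseteq> U n"
      using U(2) by blast
    then obtain \<V> where "|\<V>| \<le>o almost_Lindelof_number X" "\<And>V. V \<in> \<V> \<Longrightarrow> V \<times> V \<subseteq> U n"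
        "(\<Union>V\<in>\<V>. X closure_of V) = topspace X"
      using almost_Lindelof_bound_square_cover[OF almost_Lindelof_bound_number U(1)] by metis
    then show ?thesis
      by auto
  qed
  then obtain \<V> where \<V>: "\<And>n. |\<V> n| \<le>o almost_Lindelof_number X"
      "\<And>n V. V \<in> \<V> n \<Longrightarrow> V \<times> V \<subseteq> U n"
      "\<And>n. (\<Union>V\<in>\<V> n. X closure_of V) = topspace X"
    by metis
  have "\<forall>x n. \<exists>V. x \<in> topspace X \<longrightarrow> V \<in> \<V> n \<and> x \<in> X closure_of V"
    using \<V>(3) by blast
  then obtain c where
    c: "\<And>x n. x \<in> topspace X \<Longrightarrow> c x n \<in> \<V> n \<and> x \<in> X closure_of c x n"
    by metis
  have "inj_on c (topspace X)"
  proof (rule inj_onI)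
    fix y z assume yz: "y \<in> topspace X" "z \<in> topspace X" "c y = c z"
    have "(y, z) \<in> prod_topology X X closure_of U n" for n
    proof -
      \<comment> \<open>Since \<open>c y n = c z n\<close>, both points lie in the closure of the
        same set; a product of closures is the closure of the product.\<close>
      have "(y, z) \<in> (X closure_of c y n) \<times> (X closure_of c y n)"
        using c yz by (metis SigmaI)
      then have "(y, z) \<in> prod_topology X X closure_of (c y n \<times> c y n)"
        by (simp add: closure_of_Times)
      moreover have "c y n \<times> c y n \<subseteq> U n"
        using c[OF yz(1)] \<V>(2) by blast
      ultimately show ?thesis
        using closure_of_mono[of "c y n \<times> c y n" "U n"] by blast
    qed
    \<comment> \<open>Regularity of the diagonal enters here: the pair is only known to lie in the
      closures of the \<open>U n\<close>.\<close>
    then have "(y, z) \<in> diagonal_in X"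
      using U(3) by blast
    then show "y = z"
      by (simp add: diagonal_in_def)
  qed
  then show ?thesis
    using Cinfinite_almost_Lindelof_number \<V>(1) c
    by (intro card_of_le_cexp_natLeq[where c = c and \<V> = \<V>]) auto
qed

end
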